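(* Fix $p\in(0,1)$. For each $n\in\mathbb{N}$ let $f_n:\{0,1\}^n\to\mathbb{R}$ be a function and $s_n>0$ a real number, let $\boldsymbol{\xi}=(\xi_1,\dots,\xi_n)$ have independent $\mathrm{Ber}(p)$ entries, and define for $i\in\{1,\dots,n\}$ \[ \Delta_i(\boldsymbol{\xi}):=f_n(\xi_1,\dots,\xi_{i-1},1,\xi_{i+1},\dots,\xi_n)-f_n(\xi_1,\dots,\xi_{i-1},0,\xi_{i+1},\dots,\xi_n). \] Suppose that $\max_{1\le i\le n}\Pr(\Delta_i(\boldsymbol{\xi})\le 2s_n)\le n^{-\omega(1)}$, i.e. for every $K>0$ this maximum is at most $n^{-K}$ for all sufficiently large $n$. Then, as $n\to\infty$, \[ \sup_{x\in\mathbb{R}}\Pr\left(|f_n(\boldsymbol{\xi})-x|<s_n\right)\le \max_{0\le t\le n}\binom{n}{t}p^t(1-p)^{n-t}+o(1/\sqrt n)=O(1/\sqrt n). \]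
   Context: $\mathrm{Ber}(p)$ denotes the distribution of a random variable equal to $1$ with probability $p$ and $0$ with probability $1-p$. Asymptotic notation is as $n\to\infty$ with $p$ fixed. *)

theory Defs
  imports
    "HOL-Probability.Probability"
    "HOL-Library.Landau_Symbols"
begin

text \<open>
  A point of \<open>{0,1}^n\<close> is a function \<open>nat \<Rightarrow> bool\<close> (\<open>True\<close> for 1, \<open>False\<close> for 0) whose relevant
  coordinates are \<open>1, \<dots>, n\<close>; \<^const>\<open>Pi_pmf\<close> is supported on those functions that are constantly
  \<open>False\<close> outside \<open>{1..n}\<close>, so values of \<open>f n\<close> elsewhere never matter.
\<close>

definition bernoulli_vec :: "real \<Rightarrow> nat \<Rightarrow> (nat \<Rightarrow> bool) pmf" where
  "bernoulli_vec p n = Pi_pmf {1..n} False (\<lambda>_. bernoulli_pmf p)"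

definition discrete_deriv :: "((nat \<Rightarrow> bool) \<Rightarrow> real) \<Rightarrow> nat \<Rightarrow> (nat \<Rightarrow> bool) \<Rightarrow> real" where
  "discrete_deriv g i \<xi> = g (\<xi>(i := True)) - g (\<xi>(i := False))"

end

theory Submission imports Defs "HOL-Real_Asymp.Real_Asymp" begin

text \<open>
  This is an approximate LYM argument. Reveal the points of \<open>{1..n}\<close> in a uniformly random order,
  giving a maximal chain of subsets whose level \<open>t\<close> is uniform among the sets of size \<open>t\<close>. Call a level
  typical if its binomial weight is at least \<open>n\<^sup>-\<^sup>3\<close>; the typical levels form an interval, and the others
  contribute only \<open>O(n\<^sup>-\<^sup>2)\<close>. If \<open>f\<close> increases by more than \<open>2 s\<close> at every typical step of the chain,
  then at most one typical level satisfies \<open>\<bar>f - x\<bar> < s\<close>, so the chain contributes at most the largest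
  binomial weight. A step violating this is superpolynomially unlikely under the product measure,
  and conditioning on a typical level costs only a factor \<open>n\<^sup>3\<close>.
\<close>

section \<open>Random maximal chains: counting orderings by their initial segments\<close>

text \<open>Cutting an ordering of \<open>U\<close> after \<open>card S\<close> entries is a
  bijection onto pairs of an ordering of \<open>S\<close> and one of \<open>U - S\<close>;
  concatenation is its inverse, injective because the first part has a fixed length.\<close>

lemma card_permutations_set_take:
  assumes "finite U" "S \<subseteq> U"
  shows "card {xs \<in> permutations_of_set U. set (take (card S) xs) = S}
    = fact (card S) * fact (card U - card S)"
proof -
  let ?P = "permutations_of_set S \<times> permutations_of_set (U - S)"
  have fS: "finite S" using assms finite_subset by blast
  have "{xs \<in> permutations_of_set U. set (take (card S) xs) = S} = (\<lambda>(ys, zs). ys @ zs) ` ?P"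
  proof (intro equalityI subsetI)
    fix xs assume "xs \<in> {xs \<in> permutations_of_set U. set (take (card S) xs) = S}"
    then have xs: "set xs = U" "distinct xs" "set (take (card S) xs) = S"
      by (auto simp: permutations_of_set_def)
    have d: "distinct (take (card S) xs)" "distinct (drop (card S) xs)"
      "set (take (card S) xs) \<inter> set (drop (card S) xs) = {}"
      using xs(2) by (metis append_take_drop_id distinct_append)+
    have "set (take (card S) xs) \<union> set (drop (card S) xs) = U"
      using xs(1) by (metis append_take_drop_id set_append)
    then have "(take (card S) xs, drop (card S) xs) \<in> ?P"
      using d xs(3) by (auto simp: permutations_of_set_def)
    then show "xs \<in> (\<lambda>(ys, zs). ys @ zs) ` ?P" by (intro image_eqI) auto
  next
    fix xs assume "xs \<in> (\<lambda>(ys, zs). ys @ zs) ` ?P"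
    then obtain ys zs where *: "xs = ys @ zs" "set ys = S" "distinct ys" "set zs = U - S" "distinct zs"
      by (auto simp: permutations_of_set_def)
    moreover have "length ys = card S" using * distinct_card by force
    ultimately show "xs \<in> {xs \<in> permutations_of_set U. set (take (card S) xs) = S}"
      using assms by (auto simp: permutations_of_set_def)
  qed
  moreover have "inj_on (\<lambda>(ys, zs). ys @ zs) ?P"
  proof (rule inj_onI, clarify)
    fix ys zs ys' zs' assume "ys \<in> permutations_of_set S" "ys' \<in> permutations_of_set S"
      "ys @ zs = ys' @ zs'"
    then show "ys = ys' \<and> zs = zs'"
      using length_finite_permutations_of_set by (metis append_eq_append_conv)
  qed
  ultimately show ?thesis
    using assms fS by (simp add: card_image card_cartesian_product card_Diff_subset)
qed

text \<open>Level \<open>t\<close> of a uniformly random chain is uniform among the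
  \<open>t\<close>-subsets: each of them is the initial segment of the same number t! (|U| - t)! of
  orderings, and distinct sets have disjoint families of orderings.\<close>

lemma card_permutations_set_take_in:
  assumes "finite U" "\<A> \<subseteq> {S. S \<subseteq> U \<and> card S = t}" "t \<le> card U"
  shows "real (card {xs \<in> permutations_of_set U. set (take t xs) \<in> \<A>}) =
    fact (card U) * (real (card \<A>) / real (card U choose t))"
proof -
  have fin: "finite \<A>" by (rule finite_subset[of _ "Pow U"]) (use assms in auto)
  have "{xs \<in> permutations_of_set U. set (take t xs) \<in> \<A>} =
    (\<Union>S\<in>\<A>. {xs \<in> permutations_of_set U. set (take t xs) = S})" by auto
  also have "card \<dots> = (\<Sum>S\<in>\<A>. card {xs \<in> permutations_of_set U. set (take t xs) = S})"
    by (rule card_UN_disjoint) (use fin assms in auto)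
  also have "\<dots> = (\<Sum>S\<in>\<A>. fact t * fact (card U - t))"
  proof (rule sum.cong)
    fix S assume "S \<in> \<A>"
    then have "S \<subseteq> U" "card S = t" using assms by auto
    then show "card {xs \<in> permutations_of_set U. set (take t xs) = S} = fact t * fact (card U - t)"
      using card_permutations_set_take[OF assms(1)] by metis
  qed auto
  finally show ?thesis using assms(3) by (simp add: binomial_fact)
qed

section \<open>From a single chain to the approximate LYM inequality\<close>

text \<open>Two hits of the window of width \<open>2 s\<close> force a step of size at most \<open>2 s\<close> in between.\<close>

lemma card_hits_le:
  fixes F :: "nat \<Rightarrow> real"
  assumes s: "s > 0" and W: "W \<subseteq> {..n}"
    and conv: "\<And>t u v. t \<in> W \<Longrightarrow> v \<in> W \<Longrightarrow> t \<le> u \<Longrightarrow> u \<le> v \<Longrightarrow> u \<in> W"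
  shows "card {t\<in>W. \<bar>F t - x\<bar> < s} \<le>
    1 + (n + 1) * card {t\<in>W. t < n \<and> F (Suc t) - F t \<le> 2 * s}"
proof (cases "{t\<in>W. t < n \<and> F (Suc t) - F t \<le> 2 * s} = {}")
  case True
  have finW: "finite W" using W finite_subset by blast
  have no: False if *: "t \<in> W" "v \<in> W" "t < v" "\<bar>F t - x\<bar> < s" "\<bar>F v - x\<bar> < s" for t v
  proof -
    \<comment> \<open>Convexity of \<open>W\<close> puts every level between the two hits into
      \<open>W\<close>, where no step is bad. At least one such step is taken, so the values differ
      by more than \<open>2 * s\<close>, while two hits differ by less.\<close>
    have step: "F (Suc u) - F u > 2 * s" if "t \<le> u" "u < v" for u
    proof -
      have "u \<in> W" "u < n" using conv[of t v u] that * W by auto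
      then show ?thesis using True by force
    qed
    have "F v - F t > 2 * s" using Suc_leI[OF \<open>t < v\<close>] step
    proof (induction v rule: dec_induct)
      case (step k)
      have "2 * s < F k - F t" using step by simp
      moreover have "2 * s < F (Suc k) - F k" using step by simp
      ultimately show ?case using s by linarith
    qed simp
    then show False using * by linarith
  qed
  then have "card {t\<in>W. \<bar>F t - x\<bar> < s} \<le> Suc 0"
    using finW by (subst card_le_Suc0_iff_eq) (auto, metis linorder_neqE_nat)
  then show ?thesis by simp
next
  case False
  have finW: "finite W" using W finite_subset by blast
  \<comment> \<open>One bad step already makes the error term at least \<open>n + 1\<close>, the
    number of all levels, so the trivial bound suffices.\<close>
  have "card {t\<in>W. \<bar>F t - x\<bar> < s} \<le> card {..n}"
    by (rule card_mono) (use W in auto)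
  also have "\<dots> \<le> (n + 1) * 1" by simp
  also have "\<dots> \<le> (n + 1) * card {t\<in>W. t < n \<and> F (Suc t) - F t \<le> 2 * s}"
    by (rule mult_left_mono) (use False finW in \<open>auto simp: Suc_le_eq card_gt_0_iff\<close>)
  finally show ?thesis by simp
qed

text \<open>This averages \<open>card_hits_le\<close> over all orderings of \<open>U\<close>, with
  hit counts becoming densities because each level is uniform among the sets of its size. The double
  sum bounds the expected number of bad steps by a union bound over the inserted element
  \<open>i\<close>; its denominator counts all \<open>t\<close>-sets because the lower set of the
  step is uniform among those.\<close>

lemma approximate_LYM:
  fixes F :: "'a set \<Rightarrow> real"
  assumes U: "finite U" and s: "s > 0" and W: "W \<subseteq> {..card U}"
    and conv: "\<And>t u v. t \<in> W \<Longrightarrow> v \<in> W \<Longrightarrow> t \<le> u \<Longrightarrow> u \<le> v \<Longrightarrow> u \<in> W"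
  shows "(\<Sum>t\<in>W. real (card {S. S \<subseteq> U \<and> card S = t \<and> \<bar>F S - x\<bar> < s}) / real (card U choose t)) \<le>
    1 + (real (card U) + 1) * (\<Sum>t\<in>W. \<Sum>i\<in>U.
      real (card {S. S \<subseteq> U - {i} \<and> card S = t \<and> F (insert i S) - F S \<le> 2 * s}) / real (card U choose t))"
proof -
  define n where "n = card U"
  define P where "P = permutations_of_set U"
  define A where "A t = {S. S \<subseteq> U \<and> card S = t \<and> \<bar>F S - x\<bar> < s}" for t
  define B where "B t i = {S. S \<subseteq> U - {i} \<and> card S = t \<and> F (insert i S) - F S \<le> 2 * s}" for t i
  \<comment> \<open>The condition \<open>t < n\<close> matters: at \<open>t = n\<close> both
    prefixes equal \<open>U\<close>, so the difference 0 would always count as a bad step.\<close>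
  define D where "D xs t = (t < n \<and> F (set (take (Suc t) xs)) - F (set (take t xs)) \<le> 2 * s)" for xs t
  have finP: "finite P" and cardP: "card P = fact n" using U by (auto simp: P_def n_def)
  have finW: "finite W" using W finite_subset by blast
  have take: "set (take t xs) \<subseteq> U" "card (set (take t xs)) = t" if "xs \<in> P" "t \<le> n" for xs t
  proof -
    have xs: "set xs = U" "distinct xs" using that by (auto simp: P_def permutations_of_set_def)
    show "set (take t xs) \<subseteq> U" using xs set_take_subset by metis
    have "length xs = n" using xs by (metis distinct_card n_def)
    then show "card (set (take t xs)) = t" using that xs by (simp add: distinct_card)
  qed
  \<comment> \<open>Double counting of pairs of a chain and a level, used once for hits and once for
    bad steps.\<close>
  have swap: "(\<Sum>xs\<in>P. real (card {t\<in>W. Q xs t})) = (\<Sum>t\<in>W. real (card {xs\<in>P. Q xs t}))" for Q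
    using sum.swap_restrict[OF finP finW, of "\<lambda>_ _. 1::real" Q] by simp
  have bad: "real (card {xs\<in>P. D xs t}) \<le> fact n * (\<Sum>i\<in>U. real (card (B t i)) / real (n choose t))"
    if "t \<in> W" for t
  proof -
    have t: "t \<le> n" using W that by (auto simp: n_def)
    \<comment> \<open>The element inserted at a bad step is \<open>i = xs ! t\<close>, with list
      positions counted from 0.\<close>
    have "{xs\<in>P. D xs t} \<subseteq> (\<Union>i\<in>U. {xs\<in>P. set (take t xs) \<in> B t i})"
    proof
      fix xs assume "xs \<in> {xs\<in>P. D xs t}"
      then have xs: "xs \<in> P" "D xs t" by auto
      then have sx: "set xs = U" "distinct xs" by (auto simp: P_def permutations_of_set_def)
      have len: "t < length xs" using sx xs(2) distinct_card[of xs] by (simp add: D_def n_def)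
      have "set (take (Suc t) xs) = insert (xs ! t) (set (take t xs))"
        using len by (simp add: take_Suc_conv_app_nth)
      moreover have "xs ! t \<notin> set (take t xs)"
        using len sx by (auto simp: in_set_conv_nth nth_eq_iff_index_eq)
      moreover have "xs ! t \<in> U" using len sx by auto
      ultimately show "xs \<in> (\<Union>i\<in>U. {xs\<in>P. set (take t xs) \<in> B t i})"
        using xs take[OF xs(1) t] by (auto simp: B_def D_def intro!: bexI[of _ "xs ! t"])
    qed
    then have "card {xs\<in>P. D xs t} \<le> card (\<Union>i\<in>U. {xs\<in>P. set (take t xs) \<in> B t i})"
      using finP U by (intro card_mono) auto
    also have "\<dots> \<le> (\<Sum>i\<in>U. card {xs\<in>P. set (take t xs) \<in> B t i})"
      by (rule card_UN_le[OF U])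
    finally have "real (card {xs\<in>P. D xs t}) \<le> (\<Sum>i\<in>U. real (card {xs\<in>P. set (take t xs) \<in> B t i}))"
      by (simp flip: of_nat_sum)
    also have "\<dots> = (\<Sum>i\<in>U. fact n * (real (card (B t i)) / real (n choose t)))"
      unfolding P_def n_def
      by (intro sum.cong refl card_permutations_set_take_in U) (use t in \<open>auto simp: B_def n_def\<close>)
    finally show ?thesis by (simp add: sum_distrib_left)
  qed
  have hits: "real (card {xs\<in>P. \<bar>F (set (take t xs)) - x\<bar> < s}) =
      fact n * (real (card (A t)) / real (n choose t))" if "t \<in> W" for t
  proof -
    have t: "t \<le> n" using W that by (auto simp: n_def)
    have "{xs\<in>P. \<bar>F (set (take t xs)) - x\<bar> < s} = {xs\<in>P. set (take t xs) \<in> A t}"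
      using take[OF _ t] by (auto simp: A_def)
    also have "real (card \<dots>) = fact n * (real (card (A t)) / real (n choose t))"
      unfolding P_def n_def
      by (intro card_permutations_set_take_in U) (use t in \<open>auto simp: A_def n_def\<close>)
    finally show ?thesis .
  qed
  have "fact n * (\<Sum>t\<in>W. real (card (A t)) / real (n choose t)) =
      (\<Sum>t\<in>W. real (card {xs\<in>P. \<bar>F (set (take t xs)) - x\<bar> < s}))"
    by (simp add: hits sum_distrib_left)
  also have "\<dots> = (\<Sum>xs\<in>P. real (card {t\<in>W. \<bar>F (set (take t xs)) - x\<bar> < s}))"
    by (rule swap[symmetric])
  also have "\<dots> \<le> (\<Sum>xs\<in>P. 1 + (real n + 1) * real (card {t\<in>W. D xs t}))"
  proof (rule sum_mono)
    fix xs
    have "card {t\<in>W. \<bar>F (set (take t xs)) - x\<bar> < s} \<le> 1 + (n + 1) * card {t\<in>W. D xs t}"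
      unfolding D_def
      by (rule card_hits_le[OF s _ conv, where F = "\<lambda>t. F (set (take t xs))"]) (use W in \<open>auto simp: n_def\<close>)
    then have "real (card {t\<in>W. \<bar>F (set (take t xs)) - x\<bar> < s}) \<le> real (1 + (n + 1) * card {t\<in>W. D xs t})"
      by (rule of_nat_mono)
    then show "real (card {t\<in>W. \<bar>F (set (take t xs)) - x\<bar> < s}) \<le> 1 + (real n + 1) * real (card {t\<in>W. D xs t})"
      by (simp add: algebra_simps)
  qed
  also have "\<dots> = fact n + (real n + 1) * (\<Sum>t\<in>W. real (card {xs\<in>P. D xs t}))"
    by (simp add: sum.distrib cardP swap flip: sum_distrib_left)
  also have "\<dots> \<le> fact n + (real n + 1) * (\<Sum>t\<in>W. fact n * (\<Sum>i\<in>U. real (card (B t i)) / real (n choose t)))"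
    by (intro add_left_mono mult_left_mono sum_mono bad) auto
  also have "\<dots> = fact n * (1 + (real n + 1) * (\<Sum>t\<in>W. \<Sum>i\<in>U. real (card (B t i)) / real (n choose t)))"
    by (simp add: algebra_simps sum_distrib_left)
  finally show ?thesis by (simp add: A_def B_def n_def)
qed

section \<open>The product measure as a weighted count of sets\<close>

text \<open>The measure lives on functions that are \<open>False\<close> outside
  \<open>{1..n}\<close>, which are exactly the indicators of subsets of \<open>{1..n}\<close>. The
  weight of a subset depends only on its size, which is what connects the measure to chains.\<close>

lemma prob_bernoulli_vec:
  assumes p: "0 \<le> p" "p \<le> 1"
  shows "measure_pmf.prob (bernoulli_vec p n) X =
    (\<Sum>S | S \<subseteq> {1..n} \<and> (\<lambda>i. i \<in> S) \<in> X. p ^ card S * (1 - p) ^ (n - card S))"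
proof -
  let ?I = "\<lambda>S i. i \<in> (S :: nat set)"
  have sub: "set_pmf (bernoulli_vec p n) \<subseteq> ?I ` Pow {1..n}"
  proof
    fix \<xi> assume "\<xi> \<in> set_pmf (bernoulli_vec p n)"
    then have "\<xi> i = False" if "i \<notin> {1..n}" for i
      using that set_Pi_pmf_subset[of "{1..n}" False "\<lambda>_. bernoulli_pmf p"]
      by (auto simp: bernoulli_vec_def)
    then have "{i. \<xi> i} \<in> Pow {1..n}" by blast
    then show "\<xi> \<in> ?I ` Pow {1..n}" by (intro image_eqI[of _ _ "{i. \<xi> i}"]) auto
  qed
  have pmf: "pmf (bernoulli_vec p n) (?I S) = p ^ card S * (1 - p) ^ (n - card S)" if "S \<subseteq> {1..n}" for S
  proof -
    have "pmf (bernoulli_vec p n) (?I S) = (\<Prod>i\<in>{1..n}. pmf (bernoulli_pmf p) (i \<in> S))"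
      unfolding bernoulli_vec_def using that by (subst pmf_Pi') auto
    also have "\<dots> = (\<Prod>i\<in>{1..n}. if i \<in> S then p else 1 - p)"
      using p by (intro prod.cong) auto
    also have "\<dots> = (\<Prod>i\<in>{1..n} \<inter> S. p) * (\<Prod>i\<in>{1..n} - S. 1 - p)"
      by (subst prod.If_cases) (auto simp: Diff_eq)
    also have "\<dots> = p ^ card S * (1 - p) ^ (n - card S)"
      using that finite_subset[OF that] by (simp add: Int_absorb1 card_Diff_subset)
    finally show ?thesis .
  qed
  have inj: "inj_on ?I Y" for Y
    by (rule inj_onI) (metis Collect_mem_eq)
  let ?T = "{S. S \<subseteq> {1..n} \<and> ?I S \<in> X}"
  have "measure_pmf.prob (bernoulli_vec p n) X = measure_pmf.prob (bernoulli_vec p n) (?I ` ?T)"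
    by (rule measure_prob_cong_0) (use sub in \<open>auto simp: set_pmf_eq\<close>)
  also have "\<dots> = sum (pmf (bernoulli_vec p n)) (?I ` ?T)"
    by (rule measure_measure_pmf_finite) auto
  also have "\<dots> = (\<Sum>S\<in>?T. pmf (bernoulli_vec p n) (?I S))"
    by (subst sum.reindex[OF inj]) simp
  also have "\<dots> = (\<Sum>S\<in>?T. p ^ card S * (1 - p) ^ (n - card S))"
    using pmf by (intro sum.cong) auto
  finally show ?thesis .
qed

section \<open>Binomial weights: unimodality and size of the maximum\<close>

lemma binomial_pmf_eq_0:
  assumes "0 \<le> p" "p \<le> 1" "n < t"
  shows "pmf (binomial_pmf n p) t = 0"
  using assms by simp

text \<open>The ratio of successive weights, cross-multiplied so that no division occurs; at
  \<open>t = n\<close> both sides vanish.\<close>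

lemma binomial_pmf_step:
  assumes p: "0 < p" "p < 1" and t: "t \<le> n"
  shows "(real t + 1) * (1 - p) * pmf (binomial_pmf n p) (Suc t) =
    (real n - real t) * p * pmf (binomial_pmf n p) t"
proof (cases "t = n")
  case True
  then show ?thesis using p by simp
next
  case False
  then obtain m where m: "n - t = Suc m" "n - Suc t = m" using t by (cases "n - t") auto
  have "Suc t * (n choose Suc t) = (n - t) * (n choose t)"
    by (metis binomial_absorb_comp binomial_absorption mult.commute)
  then have c: "(real t + 1) * real (n choose Suc t) = (real n - real t) * real (n choose t)"
    using t by (metis of_nat_Suc of_nat_diff of_nat_mult add.commute)
  have "(real t + 1) * (1 - p) * pmf (binomial_pmf n p) (Suc t) =
    ((real t + 1) * real (n choose Suc t)) * (p * p ^ t * (1 - p) ^ m * (1 - p))"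
    using p m by simp
  also have "\<dots> = (real n - real t) * p * pmf (binomial_pmf n p) t"
    unfolding c using p m by simp
  finally show ?thesis .
qed

text \<open>The ratio (n - t) p / ((t + 1) (1 - p)) is at least 1 when t + 1 \<le> (n + 1) p, the
  threshold that locates the mode.\<close>

lemma binomial_pmf_increasing:
  assumes p: "0 < p" "p < 1" and "real (Suc t) \<le> (real n + 1) * p"
  shows "pmf (binomial_pmf n p) t \<le> pmf (binomial_pmf n p) (Suc t)"
proof -
  have "(real n + 1) * p < real n + 1" using p by simp
  then have t: "t \<le> n" using assms by linarith
  have "((real t + 1) * (1 - p)) * pmf (binomial_pmf n p) t \<le> ((real n - real t) * p) * pmf (binomial_pmf n p) t"
    using assms by (intro mult_right_mono) (auto simp: algebra_simps)
  also have "\<dots> = ((real t + 1) * (1 - p)) * pmf (binomial_pmf n p) (Suc t)"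
    using binomial_pmf_step[OF p t] by simp
  finally show ?thesis using p by (simp add: mult_le_cancel_left_pos)
qed

lemma binomial_pmf_decreasing:
  assumes p: "0 < p" "p < 1" and "real (Suc t) \<ge> (real n + 1) * p"
  shows "pmf (binomial_pmf n p) (Suc t) \<le> pmf (binomial_pmf n p) t"
proof (cases "t \<le> n")
  case t: True
  have "((real t + 1) * (1 - p)) * pmf (binomial_pmf n p) (Suc t) = ((real n - real t) * p) * pmf (binomial_pmf n p) t"
    using binomial_pmf_step[OF p t] by simp
  also have "\<dots> \<le> ((real t + 1) * (1 - p)) * pmf (binomial_pmf n p) t"
    using assms by (intro mult_right_mono) (auto simp: algebra_simps)
  finally show ?thesis using p by (simp add: mult_le_cancel_left_pos)
next
  case False
  then have "pmf (binomial_pmf n p) (Suc t) = 0" using p by (intro binomial_pmf_eq_0) auto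
  then show ?thesis by (metis pmf_nonneg)
qed

text \<open>Left of the threshold (n + 1) p the weights increase up to \<open>u\<close>, so
  \<open>t\<close> is the comparison point; right of it they decrease from \<open>u\<close> on, so
  \<open>v\<close> is. This makes the set of typical levels convex.\<close>

lemma binomial_pmf_unimodal:
  assumes p: "0 < p" "p < 1" and "t \<le> u" "u \<le> v"
  shows "min (pmf (binomial_pmf n p) t) (pmf (binomial_pmf n p) v) \<le> pmf (binomial_pmf n p) u"
proof (cases "real u \<le> (real n + 1) * p")
  case True
  have "pmf (binomial_pmf n p) t \<le> pmf (binomial_pmf n p) u"
    using \<open>t \<le> u\<close> True
  proof (induction u rule: dec_induct)
    case (step k)
    then show ?case using binomial_pmf_increasing[OF p, of k n] by simp
  qed simp
  then show ?thesis by simp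
next
  case False
  have "pmf (binomial_pmf n p) v \<le> pmf (binomial_pmf n p) u"
    using \<open>u \<le> v\<close>
  proof (induction v rule: dec_induct)
    case (step k)
    then show ?case using binomial_pmf_decreasing[OF p, of n k] False by simp
  qed simp
  then show ?thesis by simp
qed

text \<open>The successive ratios to the right of a mode are close enough to 1 that the
  \<open>\<surd>(n p (1 - p) / 2)\<close> values after it are all at least half the maximum.\<close>

lemma binomial_pmf_le:
  assumes p: "0 < p" "p < 1" and n: "n > 0"
  shows "pmf (binomial_pmf n p) t \<le> 2 / sqrt (real n * p * (1 - p) / 2)"
proof -
  let ?b = "pmf (binomial_pmf n p)"
  define r where "r = real n * p * (1 - p)"
  have r: "r > 0" using p n by (simp add: r_def)
  obtain k where k: "k \<le> n" "\<And>t. t \<le> n \<Longrightarrow> ?b t \<le> ?b k"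
  proof -
    have "Max (?b ` {..n}) \<in> ?b ` {..n}" by (rule Max_in) auto
    then obtain k where "k \<le> n" "Max (?b ` {..n}) = ?b k" by (metis (no_types, lifting) imageE atMost_iff)
    then show thesis using that[of k] by (metis Max_ge atMost_iff finite_atMost finite_imageI imageI)
  qed
  have bk: "?b k > 0" using p k by simp
  note [simp del] = pmf_binomial
  have max: "?b t \<le> ?b k" for t
    using k(2) binomial_pmf_eq_0[of p n t] p by (cases "t \<le> n") auto
  \<comment> \<open>Comparing the mode \<open>k\<close> with its neighbours \<open>k - 1\<close> and
    \<open>k + 1\<close> pins it down: k \<le> (n + 1) p \<le> k + 1.\<close>
  have mode1: "real k \<le> (real n + 1) * p"
  proof (cases k)
    case (Suc j)
    then have j: "j \<le> n" using k by simp
    have "((real j + 1) * (1 - p)) * ?b k = ((real n - real j) * p) * ?b j"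
      using binomial_pmf_step[OF p j] Suc by simp
    also have "\<dots> \<le> ((real n - real j) * p) * ?b k"
      using max p j by (intro mult_left_mono) auto
    finally have "(real j + 1) * (1 - p) \<le> (real n - real j) * p" using bk by simp
    then show ?thesis using Suc by (simp add: algebra_simps)
  qed (use p in simp)
  have mode2: "(real n + 1) * p \<le> real k + 1"
  proof -
    have "((real n - real k) * p) * ?b k = ((real k + 1) * (1 - p)) * ?b (Suc k)"
      using binomial_pmf_step[OF p k(1)] by simp
    also have "\<dots> \<le> ((real k + 1) * (1 - p)) * ?b k"
      using max p by (intro mult_left_mono) auto
    finally have "(real n - real k) * p \<le> (real k + 1) * (1 - p)" using bk by simp
    then show ?thesis by (simp add: algebra_simps)
  qed
  \<comment> \<open>With \<open>c\<close> the denominator of the ratio, the drop times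
    \<open>c\<close> is (k + j + 1 - (n + 1) p) times the current weight. The first factor is at
    most j + 1 by \<open>mode1\<close>, and \<open>mode2\<close> gives c \<ge> r, where
    \<open>r\<close> is the variance.\<close>
  have step: "?b (Suc (k + j)) \<ge> ?b (k + j) - ?b k * (real j + 1) / r" for j
  proof (cases "k + j \<le> n")
    case True
    define c where "c = (real (k + j) + 1) * (1 - p)"
    have c: "c > 0" using p by (simp add: c_def)
    have "real n * p \<le> (real n + 1) * p" using p by (intro mult_right_mono) auto
    then have "real n * p \<le> real (k + j) + 1" using mode2 by simp
    then have "r \<le> c" unfolding r_def c_def using p by (intro mult_right_mono) auto
    have "c * ?b (Suc (k + j)) = (real n - real (k + j)) * p * ?b (k + j)"
      using binomial_pmf_step[OF p True] by (simp add: c_def)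
    also have "(real n - real (k + j)) * p = c - (real (k + j) + 1 - (real n + 1) * p)"
      by (simp add: c_def algebra_simps)
    finally have "c * (?b (k + j) - ?b (Suc (k + j))) = (real (k + j) + 1 - (real n + 1) * p) * ?b (k + j)"
      by (simp add: algebra_simps)
    also have "\<dots> \<le> (real j + 1) * ?b (k + j)"
      using mode1 by (intro mult_right_mono) auto
    also have "\<dots> \<le> (real j + 1) * ?b k" using max by (intro mult_left_mono) auto
    finally have "?b (k + j) - ?b (Suc (k + j)) \<le> (real j + 1) * ?b k / c"
      using c by (simp add: field_simps)
    also have "\<dots> \<le> (real j + 1) * ?b k / r"
      using \<open>r \<le> c\<close> r by (intro divide_left_mono) auto
    finally show ?thesis by (simp add: mult.commute)
  next
    case False
    then show ?thesis using p r binomial_pmf_eq_0[of p n] by simp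
  qed
  \<comment> \<open>The losses j + 1 add up to at most a square, as (j + 1) \<le> (2 j + 1), the
    difference of consecutive squares.\<close>
  have decay: "?b (k + j) \<ge> ?b k * (1 - (real j)\<^sup>2 / r)" for j
  proof (induction j)
    case (Suc j)
    have "?b k * (1 - (real (Suc j))\<^sup>2 / r) = ?b k * (1 - (real j)\<^sup>2 / r) - ?b k * (2 * real j + 1) / r"
      using r by (simp add: field_simps power2_eq_square)
    moreover have "?b k * (real j + 1) / r \<le> ?b k * (2 * real j + 1) / r"
      using r by (intro divide_right_mono mult_left_mono) auto
    ultimately show ?case using Suc step[of j] by simp
  qed simp
  \<comment> \<open>For j \<le> sqrt (r / 2) the relative loss is at most 1/2. The resulting
    \<open>J + 1\<close> weights of at least half the maximum have total at most 1.\<close>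
  define J where "J = nat \<lfloor>sqrt (r / 2)\<rfloor>"
  have J: "real J \<le> sqrt (r / 2)" "sqrt (r / 2) \<le> real J + 1" using r by (auto simp: J_def)
  have half: "?b (k + j) \<ge> ?b k / 2" if "j \<le> J" for j
  proof -
    have "(real j)\<^sup>2 \<le> (sqrt (r / 2))\<^sup>2" using that J by (intro power_mono) auto
    then have "(real j)\<^sup>2 / r \<le> 1 / 2" using r by (simp add: field_simps)
    then have "?b k * (1 / 2) \<le> ?b k * (1 - (real j)\<^sup>2 / r)" by (intro mult_left_mono) auto
    then show ?thesis using decay[of j] by linarith
  qed
  have "(real J + 1) * (?b k / 2) = (\<Sum>j\<le>J. ?b k / 2)" by simp
  also have "\<dots> \<le> (\<Sum>j\<le>J. ?b (k + j))" by (rule sum_mono) (use half in auto)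
  also have "\<dots> = sum ?b ((+) k ` {..J})" by (subst sum.reindex) auto
  also have "\<dots> = measure_pmf.prob (binomial_pmf n p) ((+) k ` {..J})"
    by (rule measure_measure_pmf_finite[symmetric]) auto
  also have "\<dots> \<le> 1" by simp
  finally have "(real J + 1) * ?b k \<le> 2" by simp
  moreover have "sqrt (r / 2) * ?b k \<le> (real J + 1) * ?b k" using J by (intro mult_right_mono) auto
  ultimately have "sqrt (r / 2) * ?b t \<le> 2"
    using mult_left_mono[OF max[of t], of "sqrt (r / 2)"] real_sqrt_ge_zero[of "r / 2"] r by linarith
  then show ?thesis using r unfolding r_def[symmetric] by (simp add: field_simps)
qed

section \<open>Small-ball bound for fixed \<open>n\<close>\<close>

text \<open>Levels of weight below \<open>\<epsilon>\<close> cost at most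
  \<open>(real n + 1) * \<epsilon>\<close>; the others contribute \<open>M\<close> times the bound
  of \<open>approximate_LYM\<close>. In the last term, one factor n + 1 comes from that inequality,
  the other from the number of levels, n from the choice of \<open>i\<close>, and \<delta> /
  \<epsilon> from conditioning on a level.\<close>

lemma small_ball_bound:
  assumes p: "0 < p" "p < 1" and s: "s > 0" and \<epsilon>: "\<epsilon> > 0" 
    and M: "\<And>t. pmf (binomial_pmf n p) t \<le> M" "M \<le> 1"
    and \<delta>: "\<And>i. i \<in> {1..n} \<Longrightarrow>
      measure_pmf.prob (bernoulli_vec p n) {\<xi>. discrete_deriv f i \<xi> \<le> 2 * s} \<le> \<delta>"
  shows "measure_pmf.prob (bernoulli_vec p n) {\<xi>. \<bar>f \<xi> - x\<bar> < s} \<le>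
    M + (real n + 1) * \<epsilon> + (real n + 1)\<^sup>2 * real n * \<delta> / \<epsilon>"
proof -
  let ?b = "pmf (binomial_pmf n p)"
  define F where "F S = f (\<lambda>i. i \<in> S)" for S
  define A where "A t = {S. S \<subseteq> {1..n} \<and> card S = t \<and> \<bar>F S - x\<bar> < s}" for t
  define B where "B t i = {S. S \<subseteq> {1..n} - {i} \<and> card S = t \<and> F (insert i S) - F S \<le> 2 * s}" for t i
  define W where "W = {t. t \<le> n \<and> ?b t \<ge> \<epsilon>}"
  have finA: "finite (A t)" for t by (rule finite_subset[of _ "Pow {1..n}"]) (auto simp: A_def)
  have finW: "finite W" by (auto simp: W_def)
  have cardW: "card W \<le> n + 1"
    using card_mono[of "{..n}" W] by (auto simp: W_def)
  have M0: "0 \<le> M" using order_trans[OF pmf_nonneg M(1)] .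
  have A_le: "real (card (A t)) / real (n choose t) \<le> 1" for t
  proof -
    have "card (A t) \<le> card {S. S \<subseteq> {1..n} \<and> card S = t}"
      by (rule card_mono) (auto simp: A_def)
    then show ?thesis by (auto simp: n_subsets divide_le_eq)
  qed
  have weight: "p ^ t * (1 - p) ^ (n - t) = ?b t / real (n choose t)" if "t \<le> n" for t
    using that p by simp
  \<comment> \<open>The derivative in direction \<open>i\<close> ignores coordinate
    \<open>i\<close>, so every set in \<open>B t i\<close> lies in the event of probability at most
    \<open>\<delta>\<close>. Its members share the weight of level \<open>t\<close>, and dividing by
    \<open>?b t\<close>, which is at least \<open>\<epsilon>\<close>, leaves the density.\<close>
  have B_le: "real (card (B t i)) / real (n choose t) \<le> \<delta> / \<epsilon>" if t: "t \<in> W" and i: "i \<in> {1..n}" for t i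
  proof -
    have "real (card (B t i)) * (p ^ t * (1 - p) ^ (n - t)) = (\<Sum>S\<in>B t i. p ^ card S * (1 - p) ^ (n - card S))"
      by (simp add: B_def)
    also have "\<dots> \<le> measure_pmf.prob (bernoulli_vec p n) {\<xi>. discrete_deriv f i \<xi> \<le> 2 * s}"
    proof -
      have sub: "B t i \<subseteq> {S. S \<subseteq> {1..n} \<and> (\<lambda>j. j \<in> S) \<in> {\<xi>. discrete_deriv f i \<xi> \<le> 2 * s}}"
      proof
        fix S assume S: "S \<in> B t i"
        then have "(\<lambda>j. j \<in> S)(i := True) = (\<lambda>j. j \<in> insert i S)"
          "(\<lambda>j. j \<in> S)(i := False) = (\<lambda>j. j \<in> S)"
          by (auto simp: B_def fun_eq_iff)
        then have "discrete_deriv f i (\<lambda>j. j \<in> S) = F (insert i S) - F S"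
          unfolding discrete_deriv_def F_def by (simp only:)
        then show "S \<in> {S. S \<subseteq> {1..n} \<and> (\<lambda>j. j \<in> S) \<in> {\<xi>. discrete_deriv f i \<xi> \<le> 2 * s}}"
          using S by (auto simp: B_def)
      qed
      show ?thesis
        unfolding prob_bernoulli_vec[OF less_imp_le[OF p(1)] less_imp_le[OF p(2)]]
        by (rule sum_mono2[OF _ sub]) (use p in simp_all)
    qed
    also have "\<dots> \<le> \<delta>" by (rule \<delta>[OF i])
    finally have "real (card (B t i)) / real (n choose t) * ?b t \<le> \<delta>"
      using weight[of t] t by (simp add: W_def)
    moreover have "real (card (B t i)) / real (n choose t) * \<epsilon> \<le> real (card (B t i)) / real (n choose t) * ?b t"
      using t by (intro mult_left_mono) (auto simp: W_def)
    ultimately show ?thesis using \<epsilon> by (simp add: pos_le_divide_eq)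
  qed
  define R where "R = (real n + 1)\<^sup>2 * (real n * \<delta> / \<epsilon>)"
  \<comment> \<open>Nonnegativity of \<open>\<delta>\<close> follows from its bounding a
    probability, which requires an index; for \<open>n = 0\<close> the factor \<open>real n\<close>
    vanishes instead.\<close>
  have \<delta>\<epsilon>: "0 \<le> real n * \<delta> / \<epsilon>"
  proof (cases "n = 0")
    case False
    then have "0 \<le> \<delta>" by (intro order_trans[OF measure_nonneg \<delta>[of 1]]) auto
    then show ?thesis using \<epsilon> by simp
  qed simp
  then have R0: "0 \<le> R" unfolding R_def by (intro mult_nonneg_nonneg zero_le_power2)
  have "(\<Sum>t\<in>W. real (card (A t)) / real (n choose t)) \<le>
      1 + (real n + 1) * (\<Sum>t\<in>W. \<Sum>i\<in>{1..n}. real (card (B t i)) / real (n choose t))"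
  proof -
    have conv: "u \<in> W" if "t \<in> W" "v \<in> W" "t \<le> u" "u \<le> v" for t u v
      using binomial_pmf_unimodal[OF p that(3,4), of n] that by (auto simp: W_def min_def split: if_splits)
    have card: "card {1..n} = n" by simp
    show ?thesis
      unfolding A_def B_def
    proof (rule approximate_LYM[where U = "{1..n}", unfolded card])
      show "W \<subseteq> {..n}" by (auto simp: W_def)
      show "u \<in> W" if "t \<in> W" "v \<in> W" "t \<le> u" "u \<le> v" for t u v by (rule conv[OF that])
    qed (simp, rule s)
  qed
  also have "\<dots> \<le> 1 + (real n + 1) * (\<Sum>t\<in>W. \<Sum>i\<in>{1..n}. \<delta> / \<epsilon>)"
    by (intro add_left_mono mult_left_mono sum_mono B_le) auto
  also have "\<dots> = 1 + (real n + 1) * (real (card W) * (real n * \<delta> / \<epsilon>))" by simp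
  also have "\<dots> \<le> 1 + (real n + 1) * ((real n + 1) * (real n * \<delta> / \<epsilon>))"
    using cardW \<delta>\<epsilon> by (intro add_left_mono mult_left_mono mult_right_mono) auto
  also have "\<dots> = 1 + R" by (simp add: R_def power2_eq_square mult.assoc)
  finally have LYM: "(\<Sum>t\<in>W. real (card (A t)) / real (n choose t)) \<le> 1 + R" .
  have "measure_pmf.prob (bernoulli_vec p n) {\<xi>. \<bar>f \<xi> - x\<bar> < s} =
      (\<Sum>S\<in>(\<Union>t\<in>{..n}. A t). p ^ card S * (1 - p) ^ (n - card S))"
    using p card_mono[of "{1..n}"]
    by (subst prob_bernoulli_vec) (auto simp: A_def F_def intro!: sum.cong)
  also have "\<dots> = (\<Sum>t\<le>n. \<Sum>S\<in>A t. p ^ card S * (1 - p) ^ (n - card S))"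
    by (rule sum.UNION_disjoint) (use finA in auto, auto simp: A_def)
  also have "\<dots> = (\<Sum>t\<le>n. ?b t * (real (card (A t)) / real (n choose t)))"
  proof (rule sum.cong)
    fix t assume t: "t \<in> {..n}"
    have "(\<Sum>S\<in>A t. p ^ card S * (1 - p) ^ (n - card S)) = (\<Sum>S\<in>A t. p ^ t * (1 - p) ^ (n - t))"
      by (rule sum.cong) (auto simp: A_def)
    also have "\<dots> = ?b t * (real (card (A t)) / real (n choose t))"
      using weight[of t] t by simp
    finally show "(\<Sum>S\<in>A t. p ^ card S * (1 - p) ^ (n - card S)) = \<dots>" .
  qed simp
  \<comment> \<open>On atypical levels the density is at most 1 and the weight below
    \<open>\<epsilon>\<close>; on typical ones the weight is at most \<open>M\<close>. Every level
    is allotted an \<open>\<epsilon>\<close> to keep the sum simple.\<close>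
  also have "\<dots> \<le> (\<Sum>t\<le>n. \<epsilon> + (if t \<in> W then M * (real (card (A t)) / real (n choose t)) else 0))"
  proof (rule sum_mono)
    fix t assume t: "t \<in> {..n}"
    let ?a = "real (card (A t)) / real (n choose t)"
    have "?b t * ?a \<le> M * ?a" by (intro mult_right_mono M) auto
    moreover have "?b t * ?a \<le> \<epsilon>" if "t \<notin> W"
    proof -
      have "?b t * ?a \<le> \<epsilon> * 1" using that t A_le[of t] \<epsilon> by (intro mult_mono) (auto simp: W_def)
      then show ?thesis by simp
    qed
    ultimately show "?b t * ?a \<le> \<epsilon> + (if t \<in> W then M * ?a else 0)" using \<epsilon> by auto
  qed
  also have "\<dots> = (real n + 1) * \<epsilon> + M * (\<Sum>t\<in>W. real (card (A t)) / real (n choose t))"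
    by (simp add: sum.distrib sum_distrib_left sum.If_cases W_def Int_def conj_commute)
  also have "\<dots> \<le> (real n + 1) * \<epsilon> + M * (1 + R)"
    using M0 by (intro add_left_mono mult_left_mono LYM)
  \<comment> \<open>Here \<open>M \<le> 1\<close> absorbs the factor in front of
    \<open>R\<close>.\<close>
  also have "\<dots> \<le> (real n + 1) * \<epsilon> + (M + R)"
    using mult_right_mono[OF M(2) R0] by (simp add: distrib_left)
  finally show ?thesis by (simp add: R_def)
qed

section \<open>Choice of parameters and asymptotics\<close>

theorem theorem1p2:
  fixes p :: real
    and f :: "nat \<Rightarrow> (nat \<Rightarrow> bool) \<Rightarrow> real"
    and s :: "nat \<Rightarrow> real"
  assumes p: "0 < p" "p < 1"
    and s_pos: "\<And>n. s n > 0"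
    and deriv_large: "\<And>K::real. K > 0 \<Longrightarrow>
      \<forall>\<^sub>F n in sequentially.
        (MAX i\<in>{1..n}. measure_pmf.prob (bernoulli_vec p n)
            {\<xi>. discrete_deriv (f n) i \<xi> \<le> 2 * s n}) \<le> real n powr (- K)"
  shows "\<exists>e :: nat \<Rightarrow> real.
      e \<in> o(\<lambda>n. 1 / sqrt (real n)) \<and>
      (\<forall>n. (SUP x::real. measure_pmf.prob (bernoulli_vec p n) {\<xi>. \<bar>f n \<xi> - x\<bar> < s n})
          \<le> (MAX t\<in>{0..n}. real (n choose t) * p ^ t * (1 - p) ^ (n - t)) + e n) \<and>
      (\<lambda>n. (MAX t\<in>{0..n}. real (n choose t) * p ^ t * (1 - p) ^ (n - t)) + e n)
        \<in> O(\<lambda>n. 1 / sqrt (real n))"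
proof -
  define b where "b n t = real (n choose t) * p ^ t * (1 - p) ^ (n - t)" for n t
  define M where "M n = (MAX t\<in>{0..n}. b n t)" for n
  define P where "P n x = measure_pmf.prob (bernoulli_vec p n) {\<xi>. \<bar>f n \<xi> - x\<bar> < s n}" for n x
  \<comment> \<open>Taking the positive part of the excess makes the inequality hold for every
    \<open>n\<close>, so only the decay of \<open>e\<close> has to be shown.\<close>
  define e where "e n = max 0 ((SUP x. P n x) - M n)" for n
  have pmf_b: "pmf (binomial_pmf n p) t = b n t" for n t using p by (simp add: b_def)
  have M_ge: "pmf (binomial_pmf n p) t \<le> M n" for n t
  proof (cases "t \<le> n")
    case True
    then show ?thesis unfolding pmf_b M_def by (intro Max_ge) auto
  next
    case False
    have "pmf (binomial_pmf n p) t = 0" using False p by simp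
    also have "0 \<le> pmf (binomial_pmf n p) 0" by simp
    also have "\<dots> \<le> M n" unfolding pmf_b M_def by (intro Max_ge) auto
    finally show ?thesis .
  qed
  have M_le: "M n \<le> c" if "\<And>t. pmf (binomial_pmf n p) t \<le> c" for n c
    unfolding M_def using that by (intro Max.boundedI) (auto simp: pmf_b)
  have M_nonneg: "0 \<le> M n" for n
    by (rule order_trans[OF pmf_nonneg M_ge])
  have e_bound: "\<forall>\<^sub>F n in sequentially. norm (e n) \<le> 10 * norm (1 / (real n)\<^sup>2)"
    \<comment> \<open>With \<epsilon> = 1/n^3 and \<delta> = 1/n^8 the error terms are (n + 1)/n^3
      and (n + 1)^2/n^4, both of order 1/n^2.\<close>
    using deriv_large[of 8, simplified] eventually_gt_at_top[of 0]
  proof eventually_elim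
    case (elim n)
    have \<delta>: "measure_pmf.prob (bernoulli_vec p n) {\<xi>. discrete_deriv (f n) i \<xi> \<le> 2 * s n} \<le> 1 / real n ^ 8"
      if "i \<in> {1..n}" for i
    proof -
      have "measure_pmf.prob (bernoulli_vec p n) {\<xi>. discrete_deriv (f n) i \<xi> \<le> 2 * s n} \<le>
        (MAX i\<in>{1..n}. measure_pmf.prob (bernoulli_vec p n) {\<xi>. discrete_deriv (f n) i \<xi> \<le> 2 * s n})"
        using that by (intro Max_ge) auto
      also have "\<dots> \<le> real n powr - 8" using elim by simp
      also have "\<dots> = 1 / real n ^ 8" using elim by (simp add: powr_minus_divide)
      finally show ?thesis .
    qed
    have "P n x \<le> M n + (real n + 1) * (1 / real n ^ 3) + (real n + 1)\<^sup>2 * real n * (1 / real n ^ 8) / (1 / real n ^ 3)" for x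
      unfolding P_def
      by (rule small_ball_bound[OF p s_pos _ M_ge M_le \<delta>]) (use elim in \<open>auto simp: pmf_le_1\<close>)
    then have "(SUP x. P n x) - M n \<le> (real n + 1) * (1 / real n ^ 3) + (real n + 1)\<^sup>2 * real n * (1 / real n ^ 8) / (1 / real n ^ 3)"
      using cSUP_least[of UNIV "P n"] by (smt (verit) UNIV_not_empty)
    also have "\<dots> = (real n + 1) / real n ^ 3 + (real n + 1)\<^sup>2 / real n ^ 4"
      using elim by (simp add: field_simps eval_nat_numeral)
    also have "\<dots> \<le> (2 * real n) / real n ^ 3 + (2 * real n)\<^sup>2 / real n ^ 4"
      using elim by (intro add_mono divide_right_mono power_mono) auto
    also have "\<dots> = 6 / (real n)\<^sup>2"
      using elim by (simp add: field_simps eval_nat_numeral)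
    also have "\<dots> \<le> 10 / (real n)\<^sup>2" by (intro divide_right_mono) auto
    finally show ?case by (simp add: e_def)
  qed
  have "e \<in> O(\<lambda>n. 1 / (real n)\<^sup>2)" by (rule bigoI[OF e_bound])
  also have "(\<lambda>n. 1 / (real n)\<^sup>2) \<in> o(\<lambda>n. 1 / sqrt (real n))" by real_asymp
  finally have e_small: "e \<in> o(\<lambda>n. 1 / sqrt (real n))" .
  have "M \<in> O(\<lambda>n. 1 / sqrt (real n))"
  proof (rule bigoI)
    show "\<forall>\<^sub>F n in sequentially. norm (M n) \<le> 2 / sqrt (p * (1 - p) / 2) * norm (1 / sqrt (real n))"
      using eventually_gt_at_top[of 0]
    proof eventually_elim
      case (elim n)
      have "M n \<le> 2 / sqrt (real n * p * (1 - p) / 2)"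
        using binomial_pmf_le[OF p elim] by (rule M_le)
      then show ?case using M_nonneg[of n] by (simp add: real_sqrt_mult real_sqrt_divide mult_ac)
    qed
  qed
  then have "(\<lambda>n. M n + e n) \<in> O(\<lambda>n. 1 / sqrt (real n))"
    using e_small landau_o.small_imp_big sum_in_bigo(1) by blast
  moreover have "\<forall>n. (SUP x. P n x) \<le> M n + e n" by (auto simp: e_def)
  ultimately show ?thesis using e_small unfolding P_def M_def b_def by blast
qed

end
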